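(* Let $\Delta$ be a finite simplicial complex and let $k > p > 0$ be integers. Suppose that $f_{k-1}(\Delta) > 0$. Then $$f_{p-1}(\Delta) > \frac{(k!)^{p/k}}{p!}\left(1 + \frac{k-p}{2\sqrt[k]{k!\, f_{k-1}(\Delta)}}\right)^{p} \big(f_{k-1}(\Delta)\big)^{p/k}.$$
   Context: A simplicial complex $\Delta$ on a finite vertex set $W$ is a collection of subsets of $W$ (faces) such that $\{v\}\in\Delta$ for every $v\in W$ and every subset of a face is a face. For $i \ge 1$, $f_{i-1}(\Delta)$ denotes the number of faces of $\Delta$ having exactly $i$ vertices. *)

theory Defs
  imports Complex_Main
begin

text \<open>
  Abstract simplicial complexes; \<open>simplicial_complex\<close> in \<open>HOL-Analysis\<close> is the geometric
  notion (a set of simplices in a Euclidean space).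
\<close>

definition abstract_simplicial_complex :: "'a set \<Rightarrow> 'a set set \<Rightarrow> bool" where
  "abstract_simplicial_complex W \<Delta> \<longleftrightarrow>
     finite W \<and> \<Delta> \<subseteq> Pow W \<and> (\<forall>v\<in>W. {v} \<in> \<Delta>) \<and> (\<forall>F\<in>\<Delta>. \<forall>G. G \<subseteq> F \<longrightarrow> G \<in> \<Delta>)"

text \<open>
  The argument is the dimension of the faces counted, so \<open>face_number \<Delta> (i - 1)\<close> with
  \<open>i \<ge> 1\<close> is the number $f_{i-1}(\Delta)$ of faces with exactly \<open>i\<close> vertices.
  The empty face is never counted.
\<close>

definition face_number :: "'a set set \<Rightarrow> nat \<Rightarrow> nat" where
  "face_number \<Delta> d = card {F \<in> \<Delta>. card F = d + 1}"

end

theory Submission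
  imports Defs
begin

text \<open>
  Write \<open>f\<^bsub>k-1\<^esub> = x gchoose k\<close> with \<open>x \<ge> k\<close> real. The Lovasz form of the Kruskal-Katona theorem gives
  \<open>f\<^bsub>p-1\<^esub> \<ge> x gchoose p\<close>; following Keevash, it is obtained by induction over vertex links, bounding the
  number of faces through a vertex in two ways. With \<open>G\<^sub>n\<close> the geometric mean of
  \<open>x, x - 1, \<dots>, x - n + 1\<close> we have \<open>(k! f\<^bsub>k-1\<^esub>)\<^bsup>1/k\<^esup> = G\<^sub>k\<close>, and the claim becomes
  \<open>G\<^sub>p > G\<^sub>k + (k - p) / 2\<close>. It therefore suffices that dropping the smallest factor increases the
  geometric mean by more than \<open>1/2\<close>, which is proved by induction, splitting off the largest factor.
\<close>

section \<open>Faces by number of vertices, and vertex links\<close>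

text \<open>Indexed by the number of vertices instead of the dimension, so that the inductions on
  the size involve no truncated subtraction.\<close>

definition faces :: "'a set set \<Rightarrow> nat \<Rightarrow> 'a set set" where
  "faces \<Delta> n = {F \<in> \<Delta>. card F = n}"

definition link :: "'a set set \<Rightarrow> 'a \<Rightarrow> 'a set set" where
  "link \<Delta> v = {F. v \<notin> F \<and> insert v F \<in> \<Delta>}"

lemma abstract_simplicial_complexD:
  assumes "abstract_simplicial_complex W \<Delta>"
  shows "finite W" "finite (faces \<Delta> n)" "F \<in> \<Delta> \<Longrightarrow> finite F"
    "F \<in> \<Delta> \<Longrightarrow> F \<subseteq> W" "F \<in> \<Delta> \<Longrightarrow> G \<subseteq> F \<Longrightarrow> G \<in> \<Delta>"
    "F \<in> \<Delta> \<Longrightarrow> F - {v} \<in> \<Delta>"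
proof -
  have W: "finite W" "\<Delta> \<subseteq> Pow W" and down: "\<forall>F\<in>\<Delta>. \<forall>G. G \<subseteq> F \<longrightarrow> G \<in> \<Delta>"
    using assms unfolding abstract_simplicial_complex_def by simp_all
  show "finite W" by (fact W)
  show sub: "F \<subseteq> W" if "F \<in> \<Delta>"
    using W(2) that by blast
  show "finite F" if "F \<in> \<Delta>"
    using W(1) sub[OF that] by (rule rev_finite_subset)
  have "faces \<Delta> n \<subseteq> Pow W"
    using W(2) by (auto simp: faces_def)
  then show "finite (faces \<Delta> n)"
    using W(1) by (meson finite_Pow_iff finite_subset)
  show "G \<in> \<Delta>" if "F \<in> \<Delta>" "G \<subseteq> F"
    using down[rule_format, OF that] .
  show "F - {v} \<in> \<Delta>" if "F \<in> \<Delta>"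
    using down[rule_format, OF that] by simp
qed

text \<open>The vertex set shrinks to the neighbours of \<open>v\<close>: every vertex must itself
  be a face, and \<open>{w}\<close> lies in the link only if \<open>{v, w}\<close> is an
  edge.\<close>

lemma abstract_simplicial_complex_link:
  assumes "abstract_simplicial_complex W \<Delta>"
  shows "abstract_simplicial_complex {w \<in> W. w \<noteq> v \<and> {v, w} \<in> \<Delta>} (link \<Delta> v)"
  unfolding abstract_simplicial_complex_def
proof (intro conjI ballI allI impI)
  note fin = abstract_simplicial_complexD[OF assms]
  show "link \<Delta> v \<subseteq> Pow {w \<in> W. w \<noteq> v \<and> {v, w} \<in> \<Delta>}"
  proof (intro subsetI PowI CollectI conjI)
    fix F w
    assume "F \<in> link \<Delta> v" "w \<in> F"
    then have F: "insert v F \<in> \<Delta>" "v \<notin> F" "w \<in> F"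
      by (simp_all add: link_def)
    show "w \<in> W" using fin(4)[OF F(1)] F(3) by auto
    show "w \<noteq> v" using F by auto
    show "{v, w} \<in> \<Delta>" by (rule fin(5)[OF F(1)]) (use F in simp)
  qed
  show "G \<in> link \<Delta> v" if "F \<in> link \<Delta> v" "G \<subseteq> F" for F G
    using that fin(5)[of "insert v F" "insert v G"] by (auto simp: link_def)
  show "{w} \<in> link \<Delta> v" if "w \<in> {w \<in> W. w \<noteq> v \<and> {v, w} \<in> \<Delta>}" for w
    using that by (auto simp: link_def)
  show "finite {w \<in> W. w \<noteq> v \<and> {v, w} \<in> \<Delta>}"
    using fin(1) by simp
qed

lemma card_faces_link:
  assumes "abstract_simplicial_complex W \<Delta>"
  shows "card (faces (link \<Delta> v) n) = card {F \<in> faces \<Delta> (Suc n). v \<in> F}"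
proof (rule bij_betw_same_card[of "insert v"], rule bij_betw_byWitness[of _ "\<lambda>F. F - {v}"])
  have "finite F" if "insert v F \<in> \<Delta>" for F
    using abstract_simplicial_complexD(3)[OF assms that] by simp
  then show "insert v ` faces (link \<Delta> v) n \<subseteq> {F \<in> faces \<Delta> (Suc n). v \<in> F}"
    by (auto simp: faces_def link_def)
  show "(\<lambda>F. F - {v}) ` {F \<in> faces \<Delta> (Suc n). v \<in> F} \<subseteq> faces (link \<Delta> v) n"
    using abstract_simplicial_complexD(3)[OF assms] by (auto simp: faces_def link_def insert_absorb)
qed (auto simp: faces_def link_def)

text \<open>Deleting \<open>v\<close> maps the larger faces through \<open>v\<close> injectively to
  faces that avoid \<open>v\<close>.\<close>

lemma card_faces_containing_le:
  assumes "abstract_simplicial_complex W \<Delta>"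
  shows "card {F \<in> faces \<Delta> (Suc n). v \<in> F} + card {F \<in> faces \<Delta> n. v \<in> F} \<le> card (faces \<Delta> n)"
proof -
  note fin = abstract_simplicial_complexD[OF assms]
  have "card {F \<in> faces \<Delta> (Suc n). v \<in> F} \<le> card {F \<in> faces \<Delta> n. v \<notin> F}"
  proof (rule card_inj_on_le[of "\<lambda>F. F - {v}"])
    show "inj_on (\<lambda>F. F - {v}) {F \<in> faces \<Delta> (Suc n). v \<in> F}"
      by (rule inj_on_inverseI[where g = "insert v"]) auto
    show "(\<lambda>F. F - {v}) ` {F \<in> faces \<Delta> (Suc n). v \<in> F} \<subseteq> {F \<in> faces \<Delta> n. v \<notin> F}"
      using fin(3,6) by (auto simp: faces_def)
  qed (simp add: fin)
  moreover have "card (faces \<Delta> n) = card {F \<in> faces \<Delta> n. v \<notin> F} + card {F \<in> faces \<Delta> n. v \<in> F}"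
    by (subst card_Un_disjoint[symmetric]) (auto simp: fin intro!: arg_cong[where f = card])
  ultimately show ?thesis by linarith
qed

lemma sum_card_faces_containing:
  assumes "abstract_simplicial_complex W \<Delta>"
  shows "(\<Sum>v\<in>W. card {F \<in> faces \<Delta> n. v \<in> F}) = n * card (faces \<Delta> n)"
proof -
  note fin = abstract_simplicial_complexD[OF assms]
  have "card {v \<in> W. v \<in> F} = n" if "F \<in> faces \<Delta> n" for F
  proof -
    have "{v \<in> W. v \<in> F} = F" using that fin(4) by (auto simp: faces_def)
    then show ?thesis using that by (simp add: faces_def)
  qed
  then show ?thesis
    by (intro sum_multicount fin) auto
qed

section \<open>Binomial coefficients with real upper argument\<close>

lemma gbinomial_strict_mono:
  fixes x y :: real
  assumes "0 < n" "real n - 1 \<le> y" "y < x"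
  shows "y gchoose n < x gchoose n"
proof -
  have "(\<Prod>i=0..<n. y - real i) < (\<Prod>i=0..<n. x - real i)"
    using assms by (intro prod_mono_strict[where i = 0]) (auto simp: less_eq_real_def)
  then show ?thesis by (simp add: gbinomial_prod_rev divide_strict_right_mono)
qed

lemma gbinomial_pos:
  fixes x :: real
  assumes "real n - 1 < x"
  shows "0 < x gchoose n"
  unfolding gbinomial_prod_rev using assms by (intro divide_pos_pos prod_pos) auto

lemma gbinomial_Suc_mult:
  fixes x :: real
  shows "(real n + 1) * (x gchoose Suc n) = (x - real n) * (x gchoose n)"
  using gbinomial_mult_1[of x n] by (simp add: algebra_simps)

text \<open>Intermediate value theorem between \<open>n\<close>, where the value is 1, and
  \<open>n + m\<close>, where it is at least \<open>m\<close>. The value 0 is not attained for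
  \<open>x \<ge> n\<close>, so a count must be shown positive before it is written in this
  form.\<close>

lemma ex_gbinomial_eq:
  assumes "0 < n" "0 < m"
  shows "\<exists>x\<ge>real n. x gchoose n = real m"
proof -
  have "\<exists>x\<ge>real n. x \<le> real (n + m) \<and> x gchoose n = real m"
  proof (rule IVT)
    have "real n gchoose n = 1"
      using binomial_gbinomial[of n n, where 'a = real] by simp
    then show "real n gchoose n \<le> real m" using assms by simp
    have "m \<le> (n + m) choose n"
      using assms(1) by (induction n rule: nat_induct_non_zero) auto
    then show "real m \<le> real (n + m) gchoose n"
      using binomial_gbinomial[of "n + m" n, where 'a = real] by (metis of_nat_le_iff)
    show "\<forall>x. real n \<le> x \<and> x \<le> real (n + m) \<longrightarrow> isCont (\<lambda>x. x gchoose n) x"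
      unfolding gbinomial_prod_rev by (auto intro!: continuous_intros)
  qed simp
  then show ?thesis by blast
qed

section \<open>Lovasz form of the Kruskal-Katona theorem\<close>

text \<open>At each vertex, the number of faces of size \<open>n + 1\<close> is at most
  \<open>(x - n) / n\<close> times that of size \<open>n\<close>, which is the exact ratio in a full
  simplex on \<open>x\<close> vertices. Summing over the vertices counts each face once per vertex
  and yields the ratio \<open>(x - n) / (n + 1)\<close> of consecutive binomial
  coefficients.\<close>

lemma card_faces_Suc_le:
  assumes "abstract_simplicial_complex W \<Delta>" "0 < n" "real n \<le> x"
    and "real (card (faces \<Delta> n)) \<le> x gchoose n"
  shows "real (card (faces \<Delta> (Suc n))) \<le> x gchoose Suc n"
  using assms
proof (induction n arbitrary: W \<Delta> x)
  case (Suc r)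
  note \<Delta> = Suc.prems(1)
  let ?d = "\<lambda>v. card {F \<in> faces \<Delta> (Suc r). v \<in> F}"
  let ?e = "\<lambda>v. card {F \<in> faces \<Delta> (Suc (Suc r)). v \<in> F}"
  txt \<open>
    If \<open>v\<close> lies in many faces, compare with the faces avoiding \<open>v\<close>; otherwise apply the induction
    hypothesis to the link of \<open>v\<close>.
  \<close>
  have e_le: "(real r + 1) * real (?e v) \<le> (x - real (Suc r)) * real (?d v)" for v
  \<comment> \<open>The threshold is the degree of a vertex in the full simplex on \<open>x\<close>
    vertices. By absorption, \<open>x\<close> times it is \<open>r + 1\<close> times the bound on
    the number of all faces of this size.\<close>
  proof (cases "((x - 1) gchoose r) \<le> real (?d v)")
    case True
    have "(real r + 1) * real (?e v) \<le> (real r + 1) * (real (card (faces \<Delta> (Suc r))) - real (?d v))"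
      using card_faces_containing_le[OF \<Delta>, of "Suc r" v] by (intro mult_left_mono) auto
    also have "\<dots> \<le> (real r + 1) * (x gchoose Suc r) - (real r + 1) * real (?d v)"
      using mult_left_mono[OF Suc.prems(4), of "real r + 1"] by (simp add: right_diff_distrib)
    also have "(real r + 1) * (x gchoose Suc r) = x * ((x - 1) gchoose r)"
      using gbinomial_absorption[of r x] by (simp add: add.commute)
    also have "\<dots> \<le> x * real (?d v)"
      using True Suc.prems by (intro mult_left_mono) auto
    finally show ?thesis by (simp add: algebra_simps)
  next
    case False
    show ?thesis
    \<comment> \<open>Degree 0 cannot be written as \<open>y gchoose r\<close> with
      \<open>y \<ge> r\<close>. In that case no larger face contains \<open>v\<close> either, since
      dropping another vertex \<open>w\<close> would leave a face counted by the degree.\<close>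
    proof (cases "?d v = 0")
      case True
      have "{F \<in> faces \<Delta> (Suc (Suc r)). v \<in> F} = {}"
      proof (rule ccontr)
        assume "\<not> ?thesis"
        then obtain F where F: "F \<in> \<Delta>" "card F = Suc (Suc r)" "v \<in> F"
          by (auto simp: faces_def)
        then have "card (F - {v}) = Suc r"
          using abstract_simplicial_complexD(3)[OF \<Delta>] by simp
        then obtain w where w: "w \<in> F" "w \<noteq> v"
          by (cases "F - {v} = {}") auto
        then have "F - {w} \<in> {F \<in> faces \<Delta> (Suc r). v \<in> F}"
          using F abstract_simplicial_complexD(3,6)[OF \<Delta>] by (auto simp: faces_def)
        then show False
          using True abstract_simplicial_complexD(2)[OF \<Delta>, of "Suc r"] by auto
      qed
      then show ?thesis using True by (simp only: card.empty)
    next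
      case d: False
      \<comment> \<open>For \<open>r = 0\<close> the threshold is 1, which any nonzero degree
        reaches.\<close>
      have r: "0 < r"
        using False d by (cases r) auto
      obtain y where y: "real r \<le> y" "y gchoose r = real (?d v)"
        using ex_gbinomial_eq[of r "?d v"] r d by auto
      have "y < x - 1"
        using gbinomial_strict_mono[of r "x - 1" y] False y r Suc.prems(3)
        by (cases y "x - 1" rule: linorder_cases) auto
      have "real (card (faces (link \<Delta> v) (Suc r))) \<le> y gchoose Suc r"
        using y r by (intro Suc.IH[OF abstract_simplicial_complex_link[OF \<Delta>]])
          (auto simp: card_faces_link[OF \<Delta>])
      then have "(real r + 1) * real (?e v) \<le> (real r + 1) * (y gchoose Suc r)"
        by (simp add: card_faces_link[OF \<Delta>])
      also have "\<dots> = (y - real r) * real (?d v)"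
        by (simp add: gbinomial_Suc_mult y)
      also have "\<dots> \<le> (x - real (Suc r)) * real (?d v)"
        using \<open>y < x - 1\<close> by (intro mult_right_mono) auto
      finally show ?thesis .
    qed
  qed
  have count: "(\<Sum>v\<in>W. real (card {F \<in> faces \<Delta> n. v \<in> F})) = real n * real (card (faces \<Delta> n))" for n
    using arg_cong[OF sum_card_faces_containing[OF \<Delta>, of n], of real] by simp
  have "(real r + 1) * ((real r + 2) * real (card (faces \<Delta> (Suc (Suc r))))) =
      (\<Sum>v\<in>W. (real r + 1) * real (?e v))"
    by (simp only: sum_distrib_left[symmetric] count) (simp add: algebra_simps)
  also have "\<dots> \<le> (\<Sum>v\<in>W. (x - real (Suc r)) * real (?d v))"
    by (intro sum_mono e_le)
  also have "\<dots> = (real r + 1) * ((x - real (Suc r)) * real (card (faces \<Delta> (Suc r))))"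
    by (simp only: sum_distrib_left[symmetric] count) (simp add: algebra_simps)
  finally have "(real r + 2) * real (card (faces \<Delta> (Suc (Suc r))))
      \<le> (x - real (Suc r)) * real (card (faces \<Delta> (Suc r)))"
    by (rule mult_left_le_imp_le) simp
  also have "\<dots> \<le> (x - real (Suc r)) * (x gchoose Suc r)"
    using Suc.prems by (intro mult_left_mono) auto
  also have "\<dots> = (real r + 2) * (x gchoose Suc (Suc r))"
    using gbinomial_Suc_mult[of "Suc r" x] by (simp add: add_ac)
  finally show ?case
    by (rule mult_left_le_imp_le) simp
qed simp

text \<open>Downward induction from \<open>k\<close>, with \<open>x\<close> fixed. If there were too
  few faces of size \<open>p\<close>, their number would be \<open>y gchoose p\<close> with
  \<open>y < x\<close>, and the upper bound for the next size would contradict the induction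
  hypothesis.\<close>

theorem Lovasz_Kruskal_Katona:
  assumes \<Delta>: "abstract_simplicial_complex W \<Delta>" and "0 < p" "p \<le> k" "real k \<le> x"
    and "x gchoose k \<le> real (card (faces \<Delta> k))"
  shows "x gchoose p \<le> real (card (faces \<Delta> p))"
  using assms(3,2,4,5)
proof (induction p rule: inc_induct)
  case (step p)
  show ?case
  proof (rule ccontr)
    assume "\<not> ?thesis"
    then have less: "real (card (faces \<Delta> p)) < x gchoose p" by simp
    have IH: "x gchoose Suc p \<le> real (card (faces \<Delta> (Suc p)))"
      using step by simp
    \<comment> \<open>A face of size \<open>p + 1\<close> exists, and its subfaces make the number
      of faces of size \<open>p\<close> positive, as the choice of \<open>y\<close>
      requires.\<close>
    have "0 < x gchoose Suc p"
      using step by (intro gbinomial_pos) auto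
    with IH have "faces \<Delta> (Suc p) \<noteq> {}" by auto
    then obtain F where F: "F \<in> \<Delta>" "card F = Suc p" by (auto simp: faces_def)
    then obtain v where "v \<in> F" by (cases "F = {}") auto
    then have "F - {v} \<in> faces \<Delta> p"
      using F abstract_simplicial_complexD(3,6)[OF \<Delta>] by (auto simp: faces_def)
    then have "0 < card (faces \<Delta> p)"
      using abstract_simplicial_complexD(2)[OF \<Delta>] by (auto simp: card_gt_0_iff)
    then obtain y where y: "real p \<le> y" "y gchoose p = real (card (faces \<Delta> p))"
      using ex_gbinomial_eq[of p] step by auto
    have "y < x"
      using gbinomial_strict_mono[of p x y] less y step
      by (cases y x rule: linorder_cases) auto
    then have "y gchoose Suc p < x gchoose Suc p"
      using y by (intro gbinomial_strict_mono) auto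
    moreover have "real (card (faces \<Delta> (Suc p))) \<le> y gchoose Suc p"
      using y step by (intro card_faces_Suc_le[OF \<Delta>]) auto
    ultimately show False using IH by simp
  qed
qed simp

section \<open>A Bernoulli-type inequality\<close>

text \<open>This carries a gap of 1/2 from \<open>x - 1\<close> to \<open>x\<close> in the induction
  on geometric means. It is shown first for the smallest admissible \<open>r\<close>, by calculus in
  \<open>c\<close>, and then extended to larger \<open>r\<close> by scaling.\<close>

lemma power_add_le_Bernoulli_root:
  fixes r c :: real
  assumes c: "0 \<le> c" and r: "0 \<le> r" "1 + (real m + 2) * c \<le> r ^ (m + 2)"
  shows "(r + c) ^ (m + 1) \<le> r ^ (m + 2) * (1 + c) ^ m"
proof -
  \<comment> \<open>\<open>s t\<close> is the smallest \<open>r\<close> allowed when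
    \<open>c = t\<close>, and \<open>h t\<close> is the logarithm of the quotient of the right side
    by the left side for this \<open>r\<close>.\<close>
  define s where "s = (\<lambda>t::real. exp (ln (1 + (real m + 2) * t) / (real m + 2)))"
  define h where "h = (\<lambda>t. ln (1 + (real m + 2) * t) + real m * ln (1 + t) - (real m + 1) * ln (s t + t))"
  have s_ge: "1 \<le> s t" if "0 \<le> t" for t
    using that unfolding s_def by simp
  txt \<open>
    The derivative of \<open>h\<close> increases with \<open>s t\<close>, and setting \<open>s t\<close> to its lower bound 1 makes it vanish.
  \<close>
  have "h 0 \<le> h c"
  proof (rule DERIV_nonneg_imp_nondecreasing[OF c])
    fix t :: real
    assume t: "0 \<le> t" "t \<le> c"
    define q where "q = 1 / (1 + (real m + 2) * t)"
    have pos: "1 + (real m + 2) * t > 0"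
      using t by (intro add_pos_nonneg) auto
    have ds: "(s has_real_derivative s t * q) (at t)"
      unfolding s_def
    proof (rule DERIV_fun_exp)
      show "((\<lambda>t. ln (1 + (real m + 2) * t) / (real m + 2)) has_real_derivative q) (at t)"
        unfolding q_def using pos by (auto intro!: derivative_eq_intros)
    qed
    have sp: "s t + t > 0" using s_ge[OF t(1)] t by linarith
    have dh: "(h has_real_derivative
        (real m + 2) * q + real m / (1 + t) - (real m + 1) * ((s t * q + 1) / (s t + t))) (at t)"
      unfolding h_def
      by (rule derivative_eq_intros ds refl | use pos sp t in \<open>simp add: q_def\<close>)+
    have "(s t * q + 1) / (s t + t) \<le> (q + 1) / (1 + t)"
    proof -
      \<comment> \<open>The product is the difference of the two sides after
        cross-multiplication.\<close>
      have "0 \<le> (s t - 1) * (1 - q * t)"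
      proof (intro mult_nonneg_nonneg)
        have "1 * t \<le> 1 + (real m + 2) * t"
          using t mult_right_mono[of 1 "real m + 2" t] by auto
        then show "0 \<le> 1 - q * t"
          using pos by (simp add: q_def field_simps)
      qed (use s_ge t in auto)
      then show ?thesis
        using sp t by (simp add: frac_le_eq divide_le_0_iff) (simp add: algebra_simps)
    qed
    moreover have "(real m + 2) * q + real m / (1 + t) - (real m + 1) * ((q + 1) / (1 + t)) = 0"
      using pos t by (simp add: q_def divide_simps) (simp add: algebra_simps)
    ultimately have "(real m + 2) * q + real m / (1 + t) - (real m + 1) * ((s t * q + 1) / (s t + t)) \<ge> 0"
      using mult_left_mono[of "(s t * q + 1) / (s t + t)" "(q + 1) / (1 + t)" "real m + 1"] by linarith
    with dh show "\<exists>y. (h has_real_derivative y) (at t) \<and> 0 \<le> y" by blast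
  qed
  moreover have "h 0 = 0" by (simp add: h_def s_def)
  ultimately have hc: "0 \<le> h c" by simp
  define S where "S = s c"
  have S1: "1 \<le> S" using s_ge c by (simp add: S_def)
  have pos: "1 + (real m + 2) * c > 0"
    using c by (intro add_pos_nonneg) auto
  have Spow: "S ^ (m + 2) = 1 + (real m + 2) * c"
  proof -
    have "S ^ (m + 2) = exp (real (m + 2) * (ln (1 + (real m + 2) * c) / (real m + 2)))"
      unfolding S_def s_def by (rule exp_of_nat_mult[symmetric])
    also have "\<dots> = 1 + (real m + 2) * c" using pos by (simp add: add.commute)
    finally show ?thesis .
  qed
  have "ln ((S + c) ^ (m + 1)) \<le> ln (S ^ (m + 2) * (1 + c) ^ m)"
  proof -
    have "ln (S ^ (m + 2) * (1 + c) ^ m) = ln (S ^ (m + 2)) + ln ((1 + c) ^ m)"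
      using S1 c by (intro ln_mult_pos) auto
    also have "\<dots> = ln (1 + (real m + 2) * c) + real m * ln (1 + c)"
      using c by (simp only: Spow ln_realpow)
    finally have *: "ln (S ^ (m + 2) * (1 + c) ^ m) = ln (1 + (real m + 2) * c) + real m * ln (1 + c)" .
    have "ln ((S + c) ^ (m + 1)) = (real m + 1) * ln (S + c)"
      using S1 c by (subst ln_realpow) auto
    with * hc show ?thesis by (simp add: h_def S_def)
  qed
  then have S: "(S + c) ^ (m + 1) \<le> S ^ (m + 2) * (1 + c) ^ m"
    using S1 c by (subst (asm) ln_le_cancel_iff) auto
  \<comment> \<open>Replacing \<open>S\<close> by \<open>r\<close> multiplies the left side by at
    most the power \<open>m + 1\<close> of \<open>r / S \<ge> 1\<close>, and the right side by
    exactly the power \<open>m + 2\<close>.\<close>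
  have "S \<le> r"
    using r Spow power_mono_iff[of S r "m + 2"] S1 by simp
  then have q: "1 \<le> r / S" using S1 by simp
  have "r + c \<le> (r / S) * (S + c)"
  proof -
    have "(r / S) * (S + c) = r + (r / S) * c" using S1 by (simp add: field_simps)
    then show ?thesis using mult_right_mono[OF q c] by simp
  qed
  then have "(r + c) ^ (m + 1) \<le> ((r / S) * (S + c)) ^ (m + 1)"
    using r c by (intro power_mono) auto
  also have "\<dots> = (r / S) ^ (m + 1) * (S + c) ^ (m + 1)" by (rule power_mult_distrib)
  also have "\<dots> \<le> (r / S) ^ (m + 2) * (S ^ (m + 2) * (1 + c) ^ m)"
    using S q S1 c r by (intro mult_mono power_increasing) auto
  also have "\<dots> = r ^ (m + 2) * (1 + c) ^ m"
    using S1 by (simp add: power_divide)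
  finally show ?thesis .
qed

section \<open>Geometric means of falling factors\<close>

definition falling_gmean :: "real \<Rightarrow> nat \<Rightarrow> real" where
  "falling_gmean x n = root n (\<Prod>i<n. x - real i)"

lemma falling_gmean_power:
  assumes "real n \<le> x + 1" "0 < n"
  shows "falling_gmean x n ^ n = (\<Prod>i<n. x - real i)"
  unfolding falling_gmean_def using assms by (intro real_root_pow_pos2 prod_nonneg) auto

lemma falling_gmean_pos:
  assumes "real n < x + 1" "0 < n"
  shows "0 < falling_gmean x n"
  unfolding falling_gmean_def using assms by (intro real_root_gt_zero prod_pos) auto

lemma prod_falling_shift:
  "(\<Prod>i<Suc n. x - real i) = x * (\<Prod>i<n. (x - 1) - real i)"
  unfolding prod.lessThan_Suc_shift by (simp add: algebra_simps)

text \<open>The bound \<open>x - m / 2\<close> is the arithmetic mean of the factors. It is carried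
  along because the gap at \<open>x\<close> uses both claims at \<open>x - 1\<close>; the bound
  itself advances by applying both claims at \<open>x\<close>.\<close>

lemma falling_gmean_gap:
  assumes "real m + 1 < x"
  shows "falling_gmean x (m + 1) \<le> x - real m / 2
    \<and> falling_gmean x (m + 2) + 1 / 2 < falling_gmean x (m + 1)"
  using assms
proof (induction m arbitrary: x)
  case 0
  then have x: "1 < x" by simp
  have "x * (x - 1) < (x - 1 / 2)\<^sup>2" by (simp add: power2_eq_square algebra_simps)
  then have "sqrt (x * (x - 1)) < x - 1 / 2"
    using x by (intro real_less_lsqrt) auto
  then show ?case
    by (simp add: falling_gmean_def sqrt_def numeral_2_eq_2)
next
  case (Suc m)
  define a b u v where "a = falling_gmean (x - 1) (m + 1)" and "b = falling_gmean (x - 1) (m + 2)"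
    and "u = falling_gmean x (m + 3)" and "v = falling_gmean x (m + 2)"
  note defs = a_def b_def u_def v_def
  have ab: "a \<le> (x - 1) - real m / 2" "b + 1 / 2 < a"
    using Suc.IH[of "x - 1"] Suc.prems by (auto simp: defs)
  have v_le: "v \<le> x - real (Suc m) / 2"
    using Suc.IH[of x] Suc.prems unfolding v_def by (simp add: field_simps)
  have pos: "0 < b" "0 < u" "0 < v" "0 < x"
    using Suc.prems by (auto simp: defs intro!: falling_gmean_pos)
  have upow: "u ^ (m + 3) = x * b ^ (m + 2)"
    unfolding u_def b_def using Suc.prems prod_falling_shift[of x "m + 2"]
    by (simp add: falling_gmean_power numeral_3_eq_3 del: power_Suc prod.lessThan_Suc)
  have vpow: "v ^ (m + 2) = x * a ^ (m + 1)"
    unfolding v_def a_def using Suc.prems prod_falling_shift[of x "m + 1"]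
    by (simp add: falling_gmean_power del: power_Suc prod.lessThan_Suc)
  \<comment> \<open>Dividing by \<open>b\<close> turns \<open>u\<close> and the gap 1/2 into
    \<open>r\<close> and \<open>c\<close>. The hypothesis of
    \<open>power_add_le_Bernoulli_root\<close> then reads \<open>b + (m + 3) / 2 \<le> x\<close>,
    which is what the two bounds in \<open>ab\<close> give.\<close>
  define r c where "r = u / b" and "c = 1 / (2 * b)"
  have rpow: "r ^ (m + 3) = x / b"
    using upow pos by (simp add: r_def power_divide numeral_3_eq_3 field_simps)
  have "1 + (real (Suc m) + 2) * c = (b + (real m + 3) / 2) / b"
    using pos by (simp add: c_def field_simps)
  also have "\<dots> \<le> x / b"
    using ab pos by (intro divide_right_mono) (simp_all add: field_simps)
  finally have "1 + (real (Suc m) + 2) * c \<le> r ^ (Suc m + 2)"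
    using rpow by (simp add: numeral_3_eq_3)
  then have key: "(r + c) ^ (m + 2) \<le> r ^ (m + 3) * (1 + c) ^ (m + 1)"
    using power_add_le_Bernoulli_root[of c r "Suc m"] pos by (simp add: r_def c_def numeral_3_eq_3)
  have "(u + 1 / 2) ^ (m + 2) = b ^ (m + 2) * (r + c) ^ (m + 2)"
  proof -
    have "u + 1 / 2 = b * (r + c)"
      using pos by (simp add: r_def c_def distrib_left)
    then show ?thesis by (simp only: power_mult_distrib)
  qed
  also have "\<dots> \<le> b ^ (m + 2) * (r ^ (m + 3) * (1 + c) ^ (m + 1))"
    using key pos by (intro mult_left_mono) auto
  also have "\<dots> = x * (b * (1 + c)) ^ (m + 1)"
    using pos by (simp add: rpow power_mult_distrib)
  also have "\<dots> = x * (b + 1 / 2) ^ (m + 1)"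
    using pos by (simp add: c_def distrib_left)
  also have "\<dots> < x * a ^ (m + 1)"
    using pos ab by (intro mult_strict_left_mono power_strict_mono) auto
  also have "\<dots> = v ^ (m + 2)" by (simp only: vpow)
  finally have "u + 1 / 2 < v"
    using pos by (simp only: power_less_imp_less_base less_imp_le)
  then show ?case using v_le by (simp add: defs numeral_3_eq_3)
qed

text \<open>Telescoping: each of the \<open>k - p\<close> steps from \<open>k\<close> down to
  \<open>p\<close> gains more than 1/2.\<close>

lemma falling_gmean_less:
  assumes "0 < p" "p < k" "real k \<le> x"
  shows "falling_gmean x k + (real k - real p) / 2 < falling_gmean x p"
  using assms(2,1,3)
proof (induction p rule: strict_inc_induct)
  case (base p)
  then show ?case using falling_gmean_gap[of "p - 1" x] by (cases p) auto
next
  case (step p)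
  then show ?case using falling_gmean_gap[of "p - 1" x] by (cases p) (auto simp: field_simps)
qed

section \<open>From geometric means back to face numbers\<close>

theorem theorem1p1:
  fixes W :: "'a set" and \<Delta> :: "'a set set" and k p :: nat
  assumes "abstract_simplicial_complex W \<Delta>"
    and "k > p" and "p > 0"
    and "face_number \<Delta> (k - 1) > 0"
  shows "real (face_number \<Delta> (p - 1)) >
    (fact k :: real) powr (real p / real k) / fact p
      * (1 + (real k - real p) / (2 * root k (fact k * real (face_number \<Delta> (k - 1))))) ^ p
      * real (face_number \<Delta> (k - 1)) powr (real p / real k)"
proof -
  note \<Delta> = assms(1)
  define N where "N = card (faces \<Delta> k)"
  have fk: "face_number \<Delta> (k - 1) = N" and fp: "face_number \<Delta> (p - 1) = card (faces \<Delta> p)"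
    using assms(2,3) by (simp_all add: face_number_def faces_def N_def)
  have N: "0 < N" using assms(4) fk by simp
  obtain x where x: "real k \<le> x" "x gchoose k = real N"
    using ex_gbinomial_eq[of k N] N assms(2) by auto
  define u where "u = root k (fact k * real N)"
  have u0: "0 < u" using N assms(2) by (simp add: u_def real_root_gt_zero)
  have "u = falling_gmean x k"
    using gbinomial_mult_fact[of k x] by (simp add: u_def falling_gmean_def x lessThan_atLeast0)
  then have less: "u + (real k - real p) / 2 < falling_gmean x p"
    using falling_gmean_less[OF assms(3,2) x(1)] by simp
  have "u = (fact k * real N) powr (1 / real k)"
    using assms(2) N by (simp add: u_def root_powr_inverse)
  moreover have "u ^ p = u powr real p"
    using u0 by (rule powr_realpow[symmetric])
  ultimately have "u ^ p = (fact k * real N) powr (real p / real k)"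
    by (simp only: powr_powr) simp
  then have upow: "u ^ p = fact k powr (real p / real k) * real N powr (real p / real k)"
    by (simp add: powr_mult)
  \<comment> \<open>The two \<open>powr\<close> factors together are \<open>u ^ p\<close>; drawing
    \<open>u\<close> into the parenthesis leaves the additive form
    \<open>u + (k - p) / 2\<close>.\<close>
  have "fact k powr (real p / real k) / fact p * (1 + (real k - real p) / (2 * u)) ^ p
      * real N powr (real p / real k) = (u * (1 + (real k - real p) / (2 * u))) ^ p / fact p"
    by (simp add: power_mult_distrib upow)
  also have "u * (1 + (real k - real p) / (2 * u)) = u + (real k - real p) / 2"
    using u0 by (simp add: distrib_left)
  also have "(u + (real k - real p) / 2) ^ p / fact p < falling_gmean x p ^ p / fact p"
    using less u0 assms(2,3) by (intro divide_strict_right_mono power_strict_mono) auto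
  also have "\<dots> = x gchoose p"
    using assms(2,3) x(1) by (simp add: falling_gmean_power gbinomial_prod_rev lessThan_atLeast0)
  also have "\<dots> \<le> real (card (faces \<Delta> p))"
    using assms(2,3) x by (intro Lovasz_Kruskal_Katona[OF \<Delta>, of p k]) (auto simp: N_def)
  finally show ?thesis
    by (simp only: fk fp u_def)
qed

end
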